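(* Let $y^t \in \mathbb{R}_+^{|A|}$ be given and let $\alpha^t$ be defined by $\alpha^t_{\ell k} = q_{\ell k}(y^t)$ for all $\ell \in L$, $k \in K$. Then the linearization of $\alpha_{\ell k} y_{\ell j}$ at $(\alpha^t, y^t)$ used in problem $\mathrm{DR}(\alpha^t,y^t)$ is equivalent to the linearization of $q_{\ell k}(y) y_{\ell j}$ at $y^t$ used in problem $\text{SLP-F}(y^t)$; that is, for every $y \in \mathbb{R}_+^{|A|}$, $$\sigma_{\ell j k}(y) = \tau_{\ell j k}(y), \quad \forall\ \ell \in L,\ j \in J,\ k \in K.$$ Moreover, the two linear programs $\mathrm{DR}(\alpha^t,y^t)$ and $\text{SLP-F}(y^t)$ are equivalent (i.e., they have the same variables $y$, the same objective function and the same feasible set).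
   Context: Pooling problem data. $G=(N,A)$ is a simple acyclic directed graph; $N$ is the disjoint union of input nodes $I$, pool nodes $L$ and output nodes $J$; $A \subseteq (I\times L)\cup(I\times J)\cup(L\times J)$. $K$ is a finite set of attributes. The data are: node capacities $u_t$ ($t\in N$), arc capacities $u_{ij}$ and weights $w_{ij}$ ($(i,j)\in A$), input qualities $\lambda_{ik}$ ($i\in I,k\in K$), and quality bounds $\lambda^{\min}_{jk},\lambda^{\max}_{jk}$ ($j\in J,k\in K$). The flow vector is $y=(y_{ij})_{(i,j)\in A}$. Convention: $y_{ij}$ is defined only for $(i,j)\in A$; in all sums and expressions, terms $y_{ij}$ with $(i,j)\notin A$ are omitted (treated as $0$). Quality functions. For $\ell\in L$, $k\in K$, $$q_{\ell k}(y) := \frac{\sum_{i\in I}\lambda_{ik}y_{i\ell}}{\sum_{j\in J}y_{\ell j}} \ \text{ if } \sum_{j\in J}y_{\ell j}>0, \qquad q_{\ell k}(y):=0 \ \text{ otherwise.}$$ Linear functions. Fix $y^t\in\mathbb{R}_+^{|A|}$ and $\alpha^t_{\ell k}=q_{\ell k}(y^t)$. For $\ell\in L$, $j\in J$, $k\in K$ define $$\sigma_{\ell jk}(y) := \alpha^t_{\ell k}y_{\ell j} + \frac{y^t_{\ell j}}{\sum_{r\in J}y^t_{\ell r}}\Big(\sum_{i\in I}\lambda_{ik}y_{i\ell}-\alpha^t_{\ell k}\sum_{r\in J}y_{\ell r}\Big)\ \text{ if }\sum_{r\in J}y^t_{\ell r}>0,\qquad \sigma_{\ell jk}(y):=0\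 \text{ otherwise;}$$ $$\tau_{\ell jk}(y) := q_{\ell k}(y^t)y^t_{\ell j}+\sum_{(s,r)\in A}\frac{\partial (q_{\ell k}(y)y_{\ell j})}{\partial y_{sr}}\Big|_{y=y^t}(y_{sr}-y^t_{sr})\ \text{ if }\sum_{r\in J}y^t_{\ell r}>0,\qquad \tau_{\ell jk}(y):=0\ \text{ otherwise.}$$ (When $\sum_{r\in J}y^t_{\ell r}>0$, the partial derivatives are those of the rational function given by the first case of the definition of $q_{\ell k}$, which is smooth near $y^t$.) Linear flow constraints: (a) $\sum_{i\in I}y_{i\ell}=\sum_{j\in J}y_{\ell j}$ for all $\ell\in L$; (b) $\sum_{j\in L\cup J}y_{ij}\le u_i$ for all $i\in I$; (c) $\sum_{j\in J}y_{\ell j}\le u_\ell$ for all $\ell\in L$; (d) $\sum_{i\in I\cup L}y_{ij}\le u_j$ for all $j\in J$; (e) $0\le y_{ij}\le u_{ij}$ for all $(i,j)\in A$. Problem $\mathrm{DR}(\alpha^t,y^t)$: maximize $\sum_{(i,j)\in A}w_{ij}y_{ij}$ over $y$ subject to (a)–(e) and, for all $j\in J$, $k\in K$, $$\lambda^{\min}_{jk}\sum_{i\in I\cup L}y_{ij}\ \le\ \sum_{i\in I}\lambda_{ik}y_{ij}+\sum_{\ell\in L}\sigma_{\ell jk}(y)\ \le\ \lambda^{\max}_{jk}\sum_{i\in I\cup L}y_{ij}.$$ Problem $\text{SLP-F}(y^t)$: maximize $\sum_{(i,j)\in A}w_{ij}y_{ij}$ over $y$ subject to (a)–(e) and, for all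 $j\in J$, $k\in K$, $$\lambda^{\min}_{jk}\sum_{i\in I\cup L}y_{ij}\ \le\ \sum_{i\in I}\lambda_{ik}y_{ij}+\sum_{\ell\in L}\tau_{\ell jk}(y)\ \le\ \lambda^{\max}_{jk}\sum_{i\in I\cup L}y_{ij}.$$ *)

theory Defs
  imports "HOL-Analysis.Analysis"
begin

record ('n, 'k) pooling =
  inputs :: "'n set"
  pools :: "'n set"
  outputs :: "'n set"
  arcs :: "('n \<times> 'n) set"
  attrs :: "'k set"
  node_cap :: "'n \<Rightarrow> real"
  arc_cap :: "'n \<times> 'n \<Rightarrow> real"
  weight :: "'n \<times> 'n \<Rightarrow> real"
  input_quality :: "'n \<Rightarrow> 'k \<Rightarrow> real"
  min_quality :: "'n \<Rightarrow> 'k \<Rightarrow> real"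
  max_quality :: "'n \<Rightarrow> 'k \<Rightarrow> real"

text \<open>Arcs form a set of ordered pairs, so there are no parallel arcs; loops are excluded by
  acyclicity. Acyclicity already follows from the inclusion for the arcs and disjointness.\<close>

locale pooling_problem =
  fixes P :: "('n, 'k) pooling"
  assumes finite_nodes: "finite (inputs P)" "finite (pools P)" "finite (outputs P)"
    and disjoint_nodes: "inputs P \<inter> pools P = {}" "inputs P \<inter> outputs P = {}"
      "pools P \<inter> outputs P = {}"
    and arcs_subset: "arcs P \<subseteq> inputs P \<times> pools P \<union> inputs P \<times> outputs P \<union> pools P \<times> outputs P"
    and acyclic_arcs: "acyclic (arcs P)"
    and finite_attrs: "finite (attrs P)"

text \<open>The spaces of real and of nonnegative vectors indexed by the arcs, as extensional
  functions: a flow vector carries no information outside the arc set.\<close>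

definition flows :: "('n, 'k) pooling \<Rightarrow> ('n \<times> 'n \<Rightarrow> real) set" where
  "flows P = arcs P \<rightarrow>\<^sub>E UNIV"

definition nonneg_flows :: "('n, 'k) pooling \<Rightarrow> ('n \<times> 'n \<Rightarrow> real) set" where
  "nonneg_flows P = arcs P \<rightarrow>\<^sub>E {0..}"

text \<open>The convention that terms belonging to pairs outside the arc set are omitted.\<close>

definition flow :: "('n, 'k) pooling \<Rightarrow> ('n \<times> 'n \<Rightarrow> real) \<Rightarrow> 'n \<Rightarrow> 'n \<Rightarrow> real" where
  "flow P y s t = (if (s, t) \<in> arcs P then y (s, t) else 0)"

definition pool_quality ::
    "('n, 'k) pooling \<Rightarrow> 'n \<Rightarrow> 'k \<Rightarrow> ('n \<times> 'n \<Rightarrow> real) \<Rightarrow> real" where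
  "pool_quality P l k y =
    (if (\<Sum>j\<in>outputs P. flow P y l j) > 0
     then (\<Sum>i\<in>inputs P. input_quality P i k * flow P y i l) / (\<Sum>j\<in>outputs P. flow P y l j)
     else 0)"

definition partial_deriv :: "'a \<Rightarrow> (('a \<Rightarrow> real) \<Rightarrow> real) \<Rightarrow> ('a \<Rightarrow> real) \<Rightarrow> real" where
  "partial_deriv e f y = deriv (\<lambda>x. f (y(e := x))) (y e)"

definition sigma_lin ::
    "('n, 'k) pooling \<Rightarrow> ('n \<Rightarrow> 'k \<Rightarrow> real) \<Rightarrow> ('n \<times> 'n \<Rightarrow> real) \<Rightarrow>
      'n \<Rightarrow> 'n \<Rightarrow> 'k \<Rightarrow> ('n \<times> 'n \<Rightarrow> real) \<Rightarrow> real" where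
  "sigma_lin P \<alpha> yt l j k y =
    (if (\<Sum>r\<in>outputs P. flow P yt l r) > 0
     then \<alpha> l k * flow P y l j
       + flow P yt l j / (\<Sum>r\<in>outputs P. flow P yt l r)
         * ((\<Sum>i\<in>inputs P. input_quality P i k * flow P y i l)
            - \<alpha> l k * (\<Sum>r\<in>outputs P. flow P y l r))
     else 0)"

text \<open>The partial derivatives are taken of the piecewise-defined quality function. In the branch
  where they occur, the outflow of the pool is positive at \<open>yt\<close> and hence near \<open>yt\<close>, so they are
  the derivatives of the rational function in the first case of \<open>pool_quality\<close>.\<close>

definition tau_lin ::
    "('n, 'k) pooling \<Rightarrow> ('n \<times> 'n \<Rightarrow> real) \<Rightarrow>
      'n \<Rightarrow> 'n \<Rightarrow> 'k \<Rightarrow> ('n \<times> 'n \<Rightarrow> real) \<Rightarrow> real" where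
  "tau_lin P yt l j k y =
    (if (\<Sum>r\<in>outputs P. flow P yt l r) > 0
     then pool_quality P l k yt * flow P yt l j
       + (\<Sum>e\<in>arcs P. partial_deriv e (\<lambda>z. pool_quality P l k z * flow P z l j) yt * (y e - yt e))
     else 0)"

definition flow_constraints :: "('n, 'k) pooling \<Rightarrow> ('n \<times> 'n \<Rightarrow> real) \<Rightarrow> bool" where
  "flow_constraints P y \<longleftrightarrow>
    (\<forall>l\<in>pools P. (\<Sum>i\<in>inputs P. flow P y i l) = (\<Sum>j\<in>outputs P. flow P y l j)) \<and>
    (\<forall>i\<in>inputs P. (\<Sum>j\<in>pools P \<union> outputs P. flow P y i j) \<le> node_cap P i) \<and>
    (\<forall>l\<in>pools P. (\<Sum>j\<in>outputs P. flow P y l j) \<le> node_cap P l) \<and>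
    (\<forall>j\<in>outputs P. (\<Sum>i\<in>inputs P \<union> pools P. flow P y i j) \<le> node_cap P j) \<and>
    (\<forall>e\<in>arcs P. 0 \<le> y e \<and> y e \<le> arc_cap P e)"

text \<open>The parameter \<open>c l j k y\<close> is the expression standing for the amount of attribute \<open>k\<close>
  carried from pool \<open>l\<close> to output \<open>j\<close>.\<close>

definition quality_constraints ::
    "('n, 'k) pooling \<Rightarrow> ('n \<Rightarrow> 'n \<Rightarrow> 'k \<Rightarrow> ('n \<times> 'n \<Rightarrow> real) \<Rightarrow> real) \<Rightarrow>
      ('n \<times> 'n \<Rightarrow> real) \<Rightarrow> bool" where
  "quality_constraints P c y \<longleftrightarrow>
    (\<forall>j\<in>outputs P. \<forall>k\<in>attrs P.
      min_quality P j k * (\<Sum>i\<in>inputs P \<union> pools P. flow P y i j)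
        \<le> (\<Sum>i\<in>inputs P. input_quality P i k * flow P y i j) + (\<Sum>l\<in>pools P. c l j k y) \<and>
      (\<Sum>i\<in>inputs P. input_quality P i k * flow P y i j) + (\<Sum>l\<in>pools P. c l j k y)
        \<le> max_quality P j k * (\<Sum>i\<in>inputs P \<union> pools P. flow P y i j))"

record 'v max_problem =
  var_space :: "'v set"
  objective :: "'v \<Rightarrow> real"
  constraints :: "'v \<Rightarrow> bool"

definition feasible_set :: "'v max_problem \<Rightarrow> 'v set" where
  "feasible_set M = {y \<in> var_space M. constraints M y}"

definition equivalent_problems :: "'v max_problem \<Rightarrow> 'v max_problem \<Rightarrow> bool" where
  "equivalent_problems M M' \<longleftrightarrow>
    var_space M = var_space M' \<and>
    (\<forall>y\<in>var_space M. objective M y = objective M' y) \<and>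
    feasible_set M = feasible_set M'"

definition DR ::
    "('n, 'k) pooling \<Rightarrow> ('n \<Rightarrow> 'k \<Rightarrow> real) \<Rightarrow> ('n \<times> 'n \<Rightarrow> real) \<Rightarrow>
      ('n \<times> 'n \<Rightarrow> real) max_problem" where
  "DR P \<alpha> yt =
    \<lparr>var_space = flows P,
     objective = (\<lambda>y. \<Sum>e\<in>arcs P. weight P e * y e),
     constraints = (\<lambda>y. flow_constraints P y \<and> quality_constraints P (sigma_lin P \<alpha> yt) y)\<rparr>"

definition SLP_F ::
    "('n, 'k) pooling \<Rightarrow> ('n \<times> 'n \<Rightarrow> real) \<Rightarrow> ('n \<times> 'n \<Rightarrow> real) max_problem" where
  "SLP_F P yt =
    \<lparr>var_space = flows P,
     objective = (\<lambda>y. \<Sum>e\<in>arcs P. weight P e * y e),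
     constraints = (\<lambda>y. flow_constraints P y \<and> quality_constraints P (tau_lin P yt) y)\<rparr>"

end

theory Submission
  imports Defs
begin

text \<open>
  Fix a pool \<open>l\<close>, an output \<open>j\<close> and an attribute \<open>k\<close>. The attribute inflow \<open>N\<close> of the pool, its
  total outflow \<open>D\<close> and the flow \<open>F\<close> from \<open>l\<close> to \<open>j\<close> are linear forms in the flow
  vector. If \<open>D yt > 0\<close>, then near \<open>yt\<close> the function linearized in SLP-F is \<open>N F / D\<close>. Writing
  \<open>q = N yt / D yt\<close>, its first-order expansion at \<open>yt\<close> is, by the product and quotient rules,
  \<open>q (F y) + (F yt / D yt) (N y - N yt - q (D y - D yt))\<close>, and since \<open>N yt = q (D yt)\<close> the two
  constant terms in the last bracket cancel. What remains is
  \<open>q (F y) + (F yt / D yt) (N y - q (D y))\<close>, the linear function used in DR when \<open>\<alpha>\<close> takes the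
  value \<open>q\<close>. Otherwise both linearizations are zero by convention.

  The two linear functions agree on every real vector \<open>y\<close>. The problems DR and SLP-F differ only in
  which of them enters the quality constraints, so their feasible sets coincide.
\<close>

definition linear_form :: "'a set \<Rightarrow> ('a \<Rightarrow> real) \<Rightarrow> ('a \<Rightarrow> real) \<Rightarrow> real" where
  "linear_form A c z = (\<Sum>e\<in>A. c e * z e)"

lemma linear_form_diff:
  "linear_form A c (\<lambda>e. y e - z e) = linear_form A c y - linear_form A c z"
  by (simp add: linear_form_def right_diff_distrib sum_subtractf)

lemma linear_form_update:
  assumes "finite A" "e \<in> A"
  shows "linear_form A c (z(e := x)) = linear_form A c z + c e * (x - z e)"
proof -
  have "(\<Sum>a\<in>A - {e}. c a * (z(e := x)) a) = (\<Sum>a\<in>A - {e}. c a * z a)"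
    by (rule sum.cong) auto
  with assms show ?thesis
    by (simp add: linear_form_def sum.remove algebra_simps)
qed

lemma DERIV_linear_form_update:
  assumes "finite A" "e \<in> A"
  shows "((\<lambda>x. linear_form A c (z(e := x))) has_real_derivative c e) (at x)"
  unfolding linear_form_update[OF assms] by (auto intro!: derivative_eq_intros)

text \<open>Positivity of the denominator is an open condition along the line on which only the
  coordinate \<open>e\<close> varies. The guarded quotient therefore agrees with the rational function in a
  neighbourhood of the base point, and the quotient and product rules give its derivative.\<close>

lemma partial_deriv_guarded_quotient:
  fixes n d f :: "'a \<Rightarrow> real"
  assumes A: "finite A" "e \<in> A" and pos: "linear_form A d y0 > 0"
  defines "N \<equiv> linear_form A n y0" and "D \<equiv> linear_form A d y0" and "F \<equiv> linear_form A f y0"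
  shows "partial_deriv e
      (\<lambda>z. (if linear_form A d z > 0 then linear_form A n z / linear_form A d z else 0)
            * linear_form A f z) y0
    = N / D * f e + F / D * (n e - N / D * d e)"
proof -
  note der = DERIV_linear_form_update[OF A, where z = y0]
  let ?g = "\<lambda>x. linear_form A n (y0(e := x)) / linear_form A d (y0(e := x))
                  * linear_form A f (y0(e := x))"
  have D: "D > 0" using pos by (simp add: D_def)
  have "isCont (\<lambda>x. linear_form A d (y0(e := x))) (y0 e)"
    using der DERIV_isCont by blast
  then have "((\<lambda>x. linear_form A d (y0(e := x))) \<longlongrightarrow> linear_form A d y0) (at (y0 e))"
    by (simp add: isCont_def)
  then have "\<forall>\<^sub>F x in at (y0 e). linear_form A d (y0(e := x)) > 0"
    using pos by (rule order_tendstoD)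
  then have "\<forall>\<^sub>F x in nhds (y0 e). linear_form A d (y0(e := x)) > 0"
    using pos by (simp add: eventually_nhds_conv_at)
  then have near: "\<forall>\<^sub>F x in nhds (y0 e).
      (if linear_form A d (y0(e := x)) > 0
       then linear_form A n (y0(e := x)) / linear_form A d (y0(e := x)) else 0)
        * linear_form A f (y0(e := x)) = ?g x"
    by eventually_elim simp
  have "(?g has_real_derivative (n e * D - N * d e) / (D * D) * F + f e * (N / D)) (at (y0 e))"
    using DERIV_mult[OF DERIV_divide[OF der der] der, of d "y0 e" n f] D
    by (simp add: N_def D_def F_def)
  also have "(n e * D - N * d e) / (D * D) * F + f e * (N / D)
      = N / D * f e + F / D * (n e - N / D * d e)"
    using D by (simp add: field_simps)
  finally have "(?g has_real_derivative N / D * f e + F / D * (n e - N / D * d e)) (at (y0 e))" .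
  with near show ?thesis
    unfolding partial_deriv_def by (simp add: deriv_cong_ev DERIV_imp_deriv)
qed

text \<open>With \<open>N\<close>, \<open>D\<close>, \<open>F\<close> denoting the values at the base point, each partial derivative is a
  fixed linear combination of \<open>n e\<close>, \<open>d e\<close> and \<open>f e\<close>. Contracting with the direction \<open>y - y0\<close>
  therefore evaluates the three forms at that direction.\<close>

lemma first_order_expansion_guarded_quotient:
  fixes n d f :: "'a \<Rightarrow> real"
  assumes A: "finite A" and pos: "linear_form A d y0 > 0"
  defines "q \<equiv> linear_form A n y0 / linear_form A d y0"
  shows "q * linear_form A f y0
      + (\<Sum>e\<in>A. partial_deriv e
          (\<lambda>z. (if linear_form A d z > 0 then linear_form A n z / linear_form A d z else 0)
                * linear_form A f z) y0 * (y e - y0 e))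
    = q * linear_form A f y
      + linear_form A f y0 / linear_form A d y0
          * (linear_form A n y - q * linear_form A d y)"
    (is "_ + ?S = _")
proof -
  define r where "r = linear_form A f y0 / linear_form A d y0"
  let ?v = "\<lambda>e. y e - y0 e"
  have "?S = (\<Sum>e\<in>A. (q * f e + r * (n e - q * d e)) * ?v e)"
    using A pos by (intro sum.cong) (simp_all add: partial_deriv_guarded_quotient q_def r_def)
  also have "\<dots> = q * linear_form A f ?v + r * (linear_form A n ?v - q * linear_form A d ?v)"
    unfolding linear_form_def sum_distrib_left sum_subtractf[symmetric] sum.distrib[symmetric]
    by (intro sum.cong) (simp_all add: algebra_simps)
  finally have S: "?S = \<dots>" .
  have "linear_form A n y0 = q * linear_form A d y0"
    using pos by (simp add: q_def)
  then show ?thesis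
    unfolding S linear_form_diff r_def[symmetric] by (simp add: algebra_simps)
qed

text \<open>For a pair that is not an arc, the coefficient vector vanishes on the arc set, in agreement
  with the convention that such terms are omitted.\<close>

lemma flow_eq_linear_form:
  assumes "finite (arcs P)"
  shows "flow P z s t = linear_form (arcs P) (\<lambda>e. of_bool (e = (s, t))) z"
  using assms by (simp add: flow_def linear_form_def of_bool_def if_distrib if_distribR cong: if_cong)

lemma weighted_flow_sum_eq_linear_form:
  assumes "finite (arcs P)"
  shows "(\<Sum>i\<in>S. a i * flow P z (s i) (t i))
    = linear_form (arcs P) (\<lambda>e. \<Sum>i\<in>S. a i * of_bool (e = (s i, t i))) z"
proof -
  have "(\<Sum>i\<in>S. a i * flow P z (s i) (t i))
      = (\<Sum>i\<in>S. \<Sum>e\<in>arcs P. a i * of_bool (e = (s i, t i)) * z e)"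
    unfolding flow_eq_linear_form[OF assms] linear_form_def
    by (simp add: sum_distrib_left mult.assoc)
  also have "\<dots> = (\<Sum>e\<in>arcs P. \<Sum>i\<in>S. a i * of_bool (e = (s i, t i)) * z e)"
    by (rule sum.swap)
  finally show ?thesis
    by (simp add: linear_form_def sum_distrib_right)
qed

lemma (in pooling_problem) finite_arcs: "finite (arcs P)"
  by (rule finite_subset[OF arcs_subset]) (use finite_nodes in auto)

lemma (in pooling_problem) sigma_lin_eq_tau_lin:
  assumes \<alpha>: "\<alpha> l k = pool_quality P l k yt"
  shows "sigma_lin P \<alpha> yt l j k y = tau_lin P yt l j k y"
proof (cases "(\<Sum>r\<in>outputs P. flow P yt l r) > 0")
  case True
  let ?L = "linear_form (arcs P)"
  define n where "n = (\<lambda>e. \<Sum>i\<in>inputs P. input_quality P i k * of_bool (e = (i, l)))"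
  define d :: "'n \<times> 'n \<Rightarrow> real" where "d = (\<lambda>e. \<Sum>r\<in>outputs P. 1 * of_bool (e = (l, r)))"
  define f :: "'n \<times> 'n \<Rightarrow> real" where "f = (\<lambda>e. of_bool (e = (l, j)))"
  have N: "(\<Sum>i\<in>inputs P. input_quality P i k * flow P z i l) = ?L n z" for z
    unfolding n_def by (rule weighted_flow_sum_eq_linear_form[OF finite_arcs])
  have D: "(\<Sum>r\<in>outputs P. flow P z l r) = ?L d z" for z
    using weighted_flow_sum_eq_linear_form[OF finite_arcs, of "\<lambda>_. 1" z "\<lambda>_. l" "\<lambda>r. r"]
    by (simp add: d_def)
  have F: "flow P z l j = ?L f z" for z
    unfolding f_def by (rule flow_eq_linear_form[OF finite_arcs])
  have pos: "?L d yt > 0" using True by (simp only: D)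
  show ?thesis
    using first_order_expansion_guarded_quotient[OF finite_arcs pos, of n f y] pos
    unfolding sigma_lin_def tau_lin_def \<alpha> pool_quality_def N D F by simp
next
  case False
  then show ?thesis by (simp add: sigma_lin_def tau_lin_def)
qed

theorem theorem3p1:
  fixes P :: "('n, 'k) pooling"
    and yt :: "'n \<times> 'n \<Rightarrow> real"
    and \<alpha> :: "'n \<Rightarrow> 'k \<Rightarrow> real"
  assumes "pooling_problem P"
    and "yt \<in> nonneg_flows P"
    and "\<And>l k. l \<in> pools P \<Longrightarrow> k \<in> attrs P \<Longrightarrow> \<alpha> l k = pool_quality P l k yt"
  shows "(\<forall>y\<in>nonneg_flows P. \<forall>l\<in>pools P. \<forall>j\<in>outputs P. \<forall>k\<in>attrs P.
            sigma_lin P \<alpha> yt l j k y = tau_lin P yt l j k y) \<and>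
         equivalent_problems (DR P \<alpha> yt) (SLP_F P yt)"
proof -
  interpret pooling_problem P by fact
  have eq: "sigma_lin P \<alpha> yt l j k y = tau_lin P yt l j k y"
    if "l \<in> pools P" "k \<in> attrs P" for l j k y
    using sigma_lin_eq_tau_lin assms(3) that by metis
  have "quality_constraints P (sigma_lin P \<alpha> yt) y = quality_constraints P (tau_lin P yt) y" for y
    unfolding quality_constraints_def by (simp add: eq cong: sum.cong)
  then show ?thesis
    by (simp add: eq equivalent_problems_def feasible_set_def DR_def SLP_F_def)
qed

end
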